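(* Let $m\geq n\geq 0$, set $\mathsf{s}=\mathsf{en}$ and $\mathsf{t}=\mathsf{ne}$, and let $w$ be a word with $m$ letters $\mathsf{n}$ and $n$ letters $\mathsf{e}$. Write the expansion of $w$ in the zigzag basis of $\mathscr{P}_{m,n}$ as \[ w=\sum_{r=0}^{n}c_{w,r}\,\mathsf{s}^r\mathsf{t}^{n-r}\mathsf{n}^{m-n},\qquad c_{w,r}\in\mathbb{C}(q). \] Then each $c_{w,r}$ is a globally signed Laurent polynomial: $c_{w,r}=\varepsilon f$ for some $\varepsilon\in\{1,-1\}$ and some Laurent polynomial $f\in\mathbb{Z}_{\geq 0}[q,q^{-1}]$ with nonnegative integer coefficients.
   Context: Let $q$ be an indeterminate. $\mathscr{P}$ denotes the noncommutative associative unital $\mathbb{C}(q)$-algebra generated by $\mathsf{n},\mathsf{e}$ subject to $(1+q)\,\mathsf{ene}=q\,\mathsf{een}+\mathsf{nee}$ and $(1+q)\,\mathsf{nen}=q\,\mathsf{enn}+\mathsf{nne}$; $\mathscr{P}_{m,n}$ is the span of the words with $m$ letters $\mathsf{n}$ and $n$ letters $\mathsf{e}$. For $m\geq n$, the zigzag monomials $\mathsf{s}^a\mathsf{t}^{n-a}\mathsf{n}^{m-n}$, $0\leq a\leq n$, form a basis of $\mathscr{P}_{m,n}$ (the zigzag basis). *)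

theory Defs
  imports
    "HOL-Library.Poly_Mapping"
    "HOL-Computational_Algebra.Polynomial"
    "HOL-Computational_Algebra.Fraction_Field"
begin

section \<open>The field of rational functions and globally signed Laurent polynomials\<close>

type_synonym ratfun = "complex poly fract"

definition q :: ratfun
  where "q = Fract [:0, 1:] 1"

definition nonneg_laurent :: "ratfun set"
  where "nonneg_laurent =
    {f. \<exists>(K :: int set) (a :: int \<Rightarrow> nat). finite K \<and> f = (\<Sum>k\<in>K. of_nat (a k) * q powi k)}"

definition globally_signed :: "ratfun \<Rightarrow> bool"
  where "globally_signed c \<longleftrightarrow> (\<exists>\<epsilon>\<in>{1, -1}. \<exists>f\<in>nonneg_laurent. c = \<epsilon> * f)"


section \<open>The free algebra on two letters\<close>

datatype letter = letter_n | letter_e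

text \<open>
  The free monoid, written additively: \<^const>\<open>plus\<close> is concatenation (not commutative). With this
  instance, \<^typ>\<open>'m \<Rightarrow>\<^sub>0 'b\<close> with the convolution product of the library is the monoid algebra of
  the free monoid, that is, the free associative algebra.
\<close>

datatype free_word = Word (letters: "letter list")

instantiation free_word :: monoid_add
begin

definition zero_free_word :: free_word
  where "0 = Word []"

definition plus_free_word :: "free_word \<Rightarrow> free_word \<Rightarrow> free_word"
  where "u + v = Word (letters u @ letters v)"

instance
  by standard (simp_all add: zero_free_word_def plus_free_word_def)

end

type_synonym free_algebra = "free_word \<Rightarrow>\<^sub>0 ratfun"

definition free_gen :: "letter \<Rightarrow> free_algebra"
  where "free_gen x = Poly_Mapping.single (Word [x]) 1"

definition free_const :: "ratfun \<Rightarrow> free_algebra"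
  where "free_const c = Poly_Mapping.single 0 c"

lemma free_const_add: "free_const (a + b) = free_const a + free_const b"
  by (simp add: free_const_def single_add)

lemma free_const_mult: "free_const (a * b) = free_const a * free_const b"
  by (simp add: free_const_def mult_single)

lemma free_const_1 [simp]: "free_const 1 = 1"
  by (simp add: free_const_def)

lemma free_algebra_induct [case_names zero add]:
  fixes x :: free_algebra
  assumes "P 0" and "\<And>x u b. P x \<Longrightarrow> P (x + Poly_Mapping.single u b)"
  shows "P x"
proof (induction x rule: update_induct)
  case (update x u b)
  have "Poly_Mapping.update u b x = x + Poly_Mapping.single u b"
    using update(1)
    by (intro poly_mapping_eqI)
       (auto simp: lookup_update lookup_add lookup_single when_def in_keys_iff)
  with update assms(2) show ?case by simp
qed (rule assms(1))

lemma free_const_central: "free_const c * x = x * free_const c"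
  by (induction x rule: free_algebra_induct)
     (simp_all add: free_const_def mult_single distrib_left distrib_right mult.commute)

lemma free_word_add_eq_0_iff: "u + v = 0 \<longleftrightarrow> u = 0 \<and> v = (0 :: free_word)"
  by (cases u; cases v) (simp add: zero_free_word_def plus_free_word_def)

lemma lookup_mult_0:
  fixes x y :: free_algebra
  shows "Poly_Mapping.lookup (x * y) 0 = Poly_Mapping.lookup x 0 * Poly_Mapping.lookup y 0"
proof (induction x rule: free_algebra_induct)
  case zero
  show ?case by simp
next
  case (add x u b)
  have "Poly_Mapping.lookup (Poly_Mapping.single u b * y) 0
      = Poly_Mapping.lookup (Poly_Mapping.single u b) 0 * Poly_Mapping.lookup y 0"
  proof (induction y rule: free_algebra_induct)
    case zero
    show ?case by simp
  next
    case (add y v c)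
    have "Poly_Mapping.lookup (Poly_Mapping.single (u + v) (b * c)) 0
      = Poly_Mapping.lookup (Poly_Mapping.single u b) 0
        * Poly_Mapping.lookup (Poly_Mapping.single v c) 0"
      by (cases "u = 0"; cases "v = 0")
         (simp_all add: lookup_single_not_eq free_word_add_eq_0_iff)
    with add show ?case
      by (simp only: distrib_left lookup_add mult_single)
  qed
  with add show ?case
    by (simp only: distrib_right lookup_add)
qed


section \<open>The algebra presented by the two relations\<close>

inductive_set rel_ideal :: "free_algebra set"
  where
    rel_ene: "free_const (1 + q) * (free_gen letter_e * free_gen letter_n * free_gen letter_e)
      - (free_const q * (free_gen letter_e * free_gen letter_e * free_gen letter_n)
         + free_gen letter_n * free_gen letter_e * free_gen letter_e) \<in> rel_ideal"
  | rel_nen: "free_const (1 + q) * (free_gen letter_n * free_gen letter_e * free_gen letter_n)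
      - (free_const q * (free_gen letter_e * free_gen letter_n * free_gen letter_n)
         + free_gen letter_n * free_gen letter_n * free_gen letter_e) \<in> rel_ideal"
  | zero: "0 \<in> rel_ideal"
  | add: "x \<in> rel_ideal \<Longrightarrow> y \<in> rel_ideal \<Longrightarrow> x + y \<in> rel_ideal"
  | mult_left: "x \<in> rel_ideal \<Longrightarrow> u * x \<in> rel_ideal"
  | mult_right: "x \<in> rel_ideal \<Longrightarrow> x * u \<in> rel_ideal"

lemma rel_ideal_uminus: "x \<in> rel_ideal \<Longrightarrow> - x \<in> rel_ideal"
  using rel_ideal.mult_left[of x "- 1"] by simp

lemma lookup_free_gen_0: "Poly_Mapping.lookup (free_gen x) 0 = 0"
  by (simp add: free_gen_def lookup_single zero_free_word_def)

lemma rel_ideal_lookup_0: "x \<in> rel_ideal \<Longrightarrow> Poly_Mapping.lookup x 0 = 0"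
  by (induction rule: rel_ideal.induct)
     (simp_all add: lookup_mult_0 lookup_minus lookup_add lookup_free_gen_0)

definition pcong :: "free_algebra \<Rightarrow> free_algebra \<Rightarrow> bool"
  where "pcong x y \<longleftrightarrow> x - y \<in> rel_ideal"

lemma equivp_pcong: "equivp pcong"
proof (intro equivpI reflpI sympI transpI)
  fix x y z
  show "pcong x x"
    by (simp add: pcong_def rel_ideal.zero)
  show "pcong y x" if "pcong x y"
    using rel_ideal_uminus[of "x - y"] that by (simp add: pcong_def)
  show "pcong x z" if "pcong x y" "pcong y z"
    using rel_ideal.add[of "x - y" "y - z"] that by (simp add: pcong_def)
qed

quotient_type palg = free_algebra / pcong
  by (rule equivp_pcong)

instantiation palg :: ring_1
begin

lift_definition zero_palg :: palg is 0 .

lift_definition one_palg :: palg is 1 .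

lift_definition plus_palg :: "palg \<Rightarrow> palg \<Rightarrow> palg" is "(+)"
  unfolding pcong_def add_diff_add by (rule rel_ideal.add)

lift_definition uminus_palg :: "palg \<Rightarrow> palg" is uminus
  unfolding pcong_def minus_diff_minus by (rule rel_ideal_uminus)

lift_definition minus_palg :: "palg \<Rightarrow> palg \<Rightarrow> palg" is "(-)"
proof -
  fix a b c d :: free_algebra
  assume "pcong a b" "pcong c d"
  then have "(a - b) + - (c - d) \<in> rel_ideal"
    unfolding pcong_def by (intro rel_ideal.add rel_ideal_uminus)
  then show "pcong (a - c) (b - d)"
    by (simp add: pcong_def algebra_simps)
qed

lift_definition times_palg :: "palg \<Rightarrow> palg \<Rightarrow> palg" is "(*)"
proof -
  fix a b c d :: free_algebra
  assume "pcong a b" "pcong c d"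
  then have "(a - b) * c + b * (c - d) \<in> rel_ideal"
    unfolding pcong_def by (intro rel_ideal.intros)
  then show "pcong (a * c) (b * d)"
    by (simp add: pcong_def algebra_simps)
qed

instance
proof
  note refl = equivp_reflp[OF equivp_pcong]
  fix a b c :: palg
  show "a + b + c = a + (b + c)"
    by transfer (simp add: add.assoc refl)
  show "a + b = b + a"
    by transfer (simp add: add.commute refl)
  show "0 + a = a"
    by transfer (simp add: refl)
  show "- a + a = 0"
    by transfer (simp add: refl)
  show "a - b = a + - b"
    by transfer (simp add: refl)
  show "a * b * c = a * (b * c)"
    by transfer (simp add: mult.assoc refl)
  show "1 * a = a"
    by transfer (simp add: refl)
  show "a * 1 = a"
    by transfer (simp add: refl)
  show "(a + b) * c = a * c + b * c"
    by transfer (simp add: distrib_right refl)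
  show "a * (b + c) = a * b + a * c"
    by transfer (simp add: distrib_left refl)
  show "(0 :: palg) \<noteq> 1"
  proof transfer
    show "\<not> pcong 0 1"
      using rel_ideal_lookup_0[of "0 - 1"] by (auto simp: pcong_def lookup_minus)
  qed
qed

end

lift_definition scale :: "ratfun \<Rightarrow> palg \<Rightarrow> palg"  (infixr \<open>*\<^sub>P\<close> 75)
  is "\<lambda>c x. free_const c * x"
  unfolding pcong_def right_diff_distrib[symmetric] by (rule rel_ideal.mult_left)

interpretation palg: vector_space scale
proof
  fix a b :: ratfun and x y :: palg
  note refl = equivp_reflp[OF equivp_pcong]
  show "a *\<^sub>P (x + y) = a *\<^sub>P x + a *\<^sub>P y"
    by transfer (simp add: distrib_left refl)
  show "(a + b) *\<^sub>P x = a *\<^sub>P x + b *\<^sub>P x"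
    by transfer (simp add: free_const_add distrib_right refl)
  show "a *\<^sub>P b *\<^sub>P x = (a * b) *\<^sub>P x"
    by transfer (simp add: free_const_mult mult.assoc refl)
  show "1 *\<^sub>P x = x"
    by transfer (simp add: refl)
qed

lemma scale_mult_left: "(c *\<^sub>P x) * y = c *\<^sub>P (x * y)"
  by transfer (simp add: mult.assoc equivp_reflp[OF equivp_pcong])

lemma scale_mult_right: "x * (c *\<^sub>P y) = c *\<^sub>P (x * y)"
proof transfer
  fix x y c
  have "x * (free_const c * y) = free_const c * (x * y)"
    by (metis free_const_central mult.assoc)
  then show "pcong (x * (free_const c * y)) (free_const c * (x * y))"
    by (simp add: equivp_reflp[OF equivp_pcong])
qed

lift_definition gen :: "letter \<Rightarrow> palg" is free_gen .

abbreviation gen_n :: palg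
  where "gen_n \<equiv> gen letter_n"

abbreviation gen_e :: palg
  where "gen_e \<equiv> gen letter_e"

lemma relation_ene:
  "(1 + q) *\<^sub>P (gen_e * gen_n * gen_e)
    = q *\<^sub>P (gen_e * gen_e * gen_n) + gen_n * gen_e * gen_e"
  by transfer (unfold pcong_def, rule rel_ene)

lemma relation_nen:
  "(1 + q) *\<^sub>P (gen_n * gen_e * gen_n)
    = q *\<^sub>P (gen_e * gen_n * gen_n) + gen_n * gen_n * gen_e"
  by transfer (unfold pcong_def, rule rel_nen)


section \<open>Words and zigzag monomials\<close>

definition word :: "letter list \<Rightarrow> palg"
  where "word w = prod_list (map gen w)"

definition s_elt :: palg
  where "s_elt = gen_e * gen_n"

definition t_elt :: palg
  where "t_elt = gen_n * gen_e"

definition zigzag :: "nat \<Rightarrow> nat \<Rightarrow> nat \<Rightarrow> palg"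
  where "zigzag m n r = s_elt ^ r * t_elt ^ (n - r) * gen_n ^ (m - n)"

end

theory Submission
  imports Defs
begin

text \<open>
  The elements \<open>s\<close> and \<open>t\<close> commute, and moving a generator across a linear form in \<open>s\<close>, \<open>t\<close> applies
  an automorphism of \<open>\<complex>(q)[s, t]\<close> or its inverse. The orbit of \<open>s\<close> consists of the forms
  \<open>u\<^sub>k = [k] t - q [k - 1] s\<close> with \<open>k \<in> \<int>\<close> and \<open>[k] = (1 - q\<^sup>k) / (1 - q)\<close>; here \<open>u\<^sub>0 = s\<close>, \<open>u\<^sub>1 = t\<close>.
  Hence every word is a product of such forms times a power of a generator. In each \<open>u\<^sub>k\<close> the
  coefficients of \<open>s\<close> and \<open>t\<close> have opposite signs, so the product expands without cancellation.
  Uniqueness follows from a one-parameter family of weight modules: on a weight vector the zigzag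
  monomials take the values \<open>x\<^sup>r\<close>, with infinitely many choices of \<open>x\<close>.
\<close>

section \<open>Nonnegative Laurent polynomials\<close>

lemma q_neq_0 [simp]: "q \<noteq> 0"
  by (simp add: q_def Zero_fract_def eq_fract)

lemma q_neq_1 [simp]: "q \<noteq> 1"
  by (simp add: q_def One_fract_def eq_fract one_pCons)

lemma one_plus_q_neq_0 [simp]: "1 + q \<noteq> 0"
  by (simp add: q_def One_fract_def Zero_fract_def eq_fract one_pCons)

text \<open>Supplies the evaluation points for the polynomial identity in
  \<open>zigzag_independent\<close>; constants alone suffice.\<close>

lemma infinite_ratfun: "infinite (UNIV :: ratfun set)"
proof
  assume "finite (UNIV :: ratfun set)"
  then have "finite (range (\<lambda>c :: complex. Fract [:c:] 1))"
    by (rule finite_subset[rotated]) simp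
  moreover have "inj (\<lambda>c :: complex. Fract [:c:] 1)"
    by (auto intro: injI simp: eq_fract)
  ultimately show False
    using finite_imageD infinite_UNIV_char_0 by blast
qed

lemma nonneg_laurent_0 [simp]: "0 \<in> nonneg_laurent"
  unfolding nonneg_laurent_def by (rule CollectI, rule exI[of _ "{}"]) simp

lemma nonneg_laurent_monom: "of_nat a * q powi k \<in> nonneg_laurent"
  unfolding nonneg_laurent_def by (rule CollectI, rule exI[of _ "{k}"], rule exI[of _ "\<lambda>_. a"]) simp

lemma nonneg_laurent_powi: "q powi k \<in> nonneg_laurent"
  using nonneg_laurent_monom[of 1 k] by simp

lemma nonneg_laurent_q [simp]: "q \<in> nonneg_laurent"
  using nonneg_laurent_powi[of 1] by simp

lemma nonneg_laurent_1 [simp]: "1 \<in> nonneg_laurent"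
  using nonneg_laurent_powi[of 0] by simp

lemma nonneg_laurent_add:
  assumes "f \<in> nonneg_laurent" "g \<in> nonneg_laurent"
  shows "f + g \<in> nonneg_laurent"
proof -
  obtain K a L b where K: "finite K" "f = (\<Sum>k\<in>K. of_nat (a k) * q powi k)"
    and L: "finite L" "g = (\<Sum>k\<in>L. of_nat (b k) * q powi k)"
    using assms unfolding nonneg_laurent_def by blast
  \<comment> \<open>The coefficient functions are arbitrary outside their index sets, so they are
    cut off before the sums are merged.\<close>
  define a' where "a' k = (if k \<in> K then a k else 0)" for k
  define b' where "b' k = (if k \<in> L then b k else 0)" for k
  have "f = (\<Sum>k\<in>K \<union> L. of_nat (a' k) * q powi k)"
    unfolding K by (rule sum.mono_neutral_cong_left) (use K L in \<open>auto simp: a'_def\<close>)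
  moreover have "g = (\<Sum>k\<in>K \<union> L. of_nat (b' k) * q powi k)"
    unfolding L by (rule sum.mono_neutral_cong_left) (use K L in \<open>auto simp: b'_def\<close>)
  ultimately have "f + g = (\<Sum>k\<in>K \<union> L. of_nat (a' k + b' k) * q powi k)"
    by (simp add: sum.distrib distrib_right)
  with K(1) L(1) show ?thesis
    unfolding nonneg_laurent_def
    by (intro CollectI exI[of _ "K \<union> L"] exI[of _ "\<lambda>k. a' k + b' k"] conjI finite_UnI)
qed

lemma nonneg_laurent_sum:
  "(\<And>i. i \<in> A \<Longrightarrow> f i \<in> nonneg_laurent) \<Longrightarrow> sum f A \<in> nonneg_laurent"
  by (induction A rule: infinite_finite_induct) (auto intro: nonneg_laurent_add)

lemma nonneg_laurent_mult:
  assumes "f \<in> nonneg_laurent" "g \<in> nonneg_laurent"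
  shows "f * g \<in> nonneg_laurent"
proof -
  obtain K a L b where f: "f = (\<Sum>k\<in>K. of_nat (a k) * q powi k)"
    and g: "g = (\<Sum>l\<in>L. of_nat (b l) * q powi l)"
    using assms unfolding nonneg_laurent_def by blast
  have "f * g = (\<Sum>k\<in>K. \<Sum>l\<in>L. of_nat (a k * b l) * q powi (k + l))"
    unfolding f g sum_product by (simp add: power_int_add mult_ac)
  also have "\<dots> \<in> nonneg_laurent"
    by (intro nonneg_laurent_sum nonneg_laurent_monom)
  finally show ?thesis .
qed


section \<open>Factorisation of words\<close>

definition qnum :: "int \<Rightarrow> ratfun"
  where "qnum k = (1 - q powi k) / (1 - q)"

lemma qnum_0 [simp]: "qnum 0 = 0"
  by (simp add: qnum_def)

lemma qnum_1 [simp]: "qnum 1 = 1"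
  by (simp add: qnum_def)

lemma qnum_minus_1: "qnum (- 1) = - inverse q"
  using q_neq_0 q_neq_1 by (simp add: qnum_def power_int_minus field_simps del: q_neq_0 q_neq_1)

text \<open>The roots of X^2 = (1 + q) X - q are 1 and q, so every linear combination of 1 and
  \<open>q powi k\<close> satisfies this recurrence.\<close>

lemma qnum_rec: "qnum (k + 1) = (1 + q) * qnum k - q * qnum (k - 1)"
proof -
  have "1 - q \<noteq> 0"
    by simp
  then show ?thesis
    by (simp add: qnum_def power_int_add power_int_diff divide_simps) (simp add: algebra_simps)
qed

lemma qnum_nonneg: "qnum (int j) \<in> nonneg_laurent"
proof -
  have "qnum (int j) = (\<Sum>i<j. q ^ i)"
    using one_diff_power_eq[of q j] by (simp add: qnum_def divide_simps mult.commute)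
  then show ?thesis
    by (auto intro!: nonneg_laurent_sum simp flip: power_int_of_nat intro: nonneg_laurent_powi)
qed

lemma qnum_minus: "qnum (- k) = - (q powi (- k) * qnum k)"
  by (simp add: qnum_def power_int_minus field_simps)

definition orbit_form :: "int \<Rightarrow> palg"
  where "orbit_form k = qnum k *\<^sub>P t_elt - (q * qnum (k - 1)) *\<^sub>P s_elt"

lemma orbit_form_0: "orbit_form 0 = s_elt"
  by (simp add: orbit_form_def qnum_minus_1)

lemma orbit_form_1: "orbit_form 1 = t_elt"
  by (simp add: orbit_form_def)

text \<open>Re-bracketing gives n s = t n, and the relation for nen rewrites n t; by
  \<open>qnum_rec\<close> the resulting coefficients are those of index k + 1.\<close>

lemma gen_n_orbit_form: "gen_n * orbit_form k = orbit_form (k + 1) * gen_n"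
proof -
  have nt: "gen_n * t_elt = (1 + q) *\<^sub>P (t_elt * gen_n) - q *\<^sub>P (s_elt * gen_n)"
    using relation_nen by (simp add: s_elt_def t_elt_def mult.assoc)
  have ns: "gen_n * s_elt = t_elt * gen_n"
    by (simp add: s_elt_def t_elt_def mult.assoc)
  have "gen_n * orbit_form k = qnum k *\<^sub>P (gen_n * t_elt) - (q * qnum (k - 1)) *\<^sub>P (gen_n * s_elt)"
    by (simp add: orbit_form_def right_diff_distrib scale_mult_right)
  also have "\<dots> = ((1 + q) * qnum k - q * qnum (k - 1)) *\<^sub>P (t_elt * gen_n)
      - (q * qnum k) *\<^sub>P (s_elt * gen_n)"
    unfolding nt ns
    by (simp add: palg.scale_right_diff_distrib palg.scale_left_diff_distrib mult.commute)
  also have "\<dots> = orbit_form (k + 1) * gen_n"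
    by (simp add: orbit_form_def left_diff_distrib scale_mult_left qnum_rec)
  finally show ?thesis .
qed

lemma gen_e_orbit_form: "gen_e * orbit_form k = orbit_form (k - 1) * gen_e"
proof -
  have es: "q *\<^sub>P (gen_e * s_elt) = (1 + q) *\<^sub>P (s_elt * gen_e) - t_elt * gen_e"
    using relation_ene by (simp add: s_elt_def t_elt_def mult.assoc)
  have et: "gen_e * t_elt = s_elt * gen_e"
    by (simp add: s_elt_def t_elt_def mult.assoc)
  have "gen_e * orbit_form k = qnum k *\<^sub>P (gen_e * t_elt) - qnum (k - 1) *\<^sub>P (q *\<^sub>P (gen_e * s_elt))"
    by (simp add: orbit_form_def right_diff_distrib scale_mult_right mult.commute)
  also have "\<dots> = qnum (k - 1) *\<^sub>P (t_elt * gen_e)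
      - ((1 + q) * qnum (k - 1) - qnum k) *\<^sub>P (s_elt * gen_e)"
    unfolding es et
    by (simp add: palg.scale_right_diff_distrib palg.scale_left_diff_distrib mult.commute)
  also have "(1 + q) * qnum (k - 1) - qnum k = q * qnum (k - 1 - 1)"
    using qnum_rec[of "k - 1"] by simp
  also have "qnum (k - 1) *\<^sub>P (t_elt * gen_e) - (q * qnum (k - 1 - 1)) *\<^sub>P (s_elt * gen_e)
      = orbit_form (k - 1) * gen_e"
    by (simp add: orbit_form_def left_diff_distrib scale_mult_left)
  finally show ?thesis .
qed

lemma gen_n_prod_orbit_form:
  "gen_n * prod_list (map orbit_form L) = prod_list (map orbit_form (map (\<lambda>k. k + 1) L)) * gen_n"
proof (induction L)
  case (Cons k L)
  have "gen_n * prod_list (map orbit_form (k # L))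
      = orbit_form (k + 1) * (gen_n * prod_list (map orbit_form L))"
    by (simp add: gen_n_orbit_form flip: mult.assoc)
  then show ?case
    by (simp add: Cons.IH mult.assoc)
qed simp

lemma gen_e_prod_orbit_form:
  "gen_e * prod_list (map orbit_form L) = prod_list (map orbit_form (map (\<lambda>k. k - 1) L)) * gen_e"
proof (induction L)
  case (Cons k L)
  have "gen_e * prod_list (map orbit_form (k # L))
      = orbit_form (k - 1) * (gen_e * prod_list (map orbit_form L))"
    by (simp add: gen_e_orbit_form flip: mult.assoc)
  then show ?case
    by (simp add: Cons.IH mult.assoc)
qed simp

lemma word_Cons: "word (x # w) = gen x * word w"
  by (simp add: word_def)

text \<open>Read from the right, each new letter passes through the orbit forms, shifting their
  indices, and then either lengthens the remaining power or pairs with an opposite letter. Suffixes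
  may have more e than n, so both signs of the surplus are treated; truncated subtraction makes one
  exponent zero.\<close>

lemma word_factorisation:
  defines "f \<equiv> \<lambda>w. count_list w letter_n" and "g \<equiv> \<lambda>w. count_list w letter_e"
  shows "\<exists>L. length L = min (f w) (g w)
    \<and> word w = prod_list (map orbit_form L) * (gen_n ^ (f w - g w) * gen_e ^ (g w - f w))"
proof (induction w)
  case Nil
  show ?case
    by (simp add: word_def f_def g_def)
next
  case (Cons x w)
  then obtain L where len: "length L = min (f w) (g w)"
    and w: "word w = prod_list (map orbit_form L) * (gen_n ^ (f w - g w) * gen_e ^ (g w - f w))"
    by blast
  show ?case
  proof (cases x)
    case letter_n
    let ?L = "map (\<lambda>k. k + 1) L"
    have fg: "f (x # w) = Suc (f w)" "g (x # w) = g w"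
      by (simp_all add: f_def g_def letter_n)
    have eq: "word (x # w) = prod_list (map orbit_form ?L)
        * (gen_n * (gen_n ^ (f w - g w) * gen_e ^ (g w - f w)))"
      by (simp only: word_Cons letter_n w mult.assoc[symmetric] gen_n_prod_orbit_form)
    show ?thesis
    proof (cases "g w \<le> f w")
      case True
      then show ?thesis
        by (intro exI[of _ ?L]) (simp add: eq fg len Suc_diff_le del: map_map)
    next
      case False
      \<comment> \<open>Exposes one surplus e: with the new n it forms t, the orbit form of index 1,
        placed to the right of the shifted factors.\<close>
      then have "g w - f w = Suc (g w - Suc (f w))"
        by simp
      with False show ?thesis
        by (intro exI[of _ "?L @ [1]"])
           (simp add: eq fg len orbit_form_1 t_elt_def mult.assoc del: map_map)
    qed
  next
    case letter_e
    let ?L = "map (\<lambda>k. k - 1) L"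
    have fg: "f (x # w) = f w" "g (x # w) = Suc (g w)"
      by (simp_all add: f_def g_def letter_e)
    have eq: "word (x # w) = prod_list (map orbit_form ?L)
        * (gen_e * (gen_n ^ (f w - g w) * gen_e ^ (g w - f w)))"
      by (simp only: word_Cons letter_e w mult.assoc[symmetric] gen_e_prod_orbit_form)
    show ?thesis
    proof (cases "f w \<le> g w")
      case True
      then show ?thesis
        by (intro exI[of _ ?L]) (simp add: eq fg len Suc_diff_le del: map_map)
    next
      case False
      then have "f w - g w = Suc (f w - Suc (g w))"
        by simp
      with False show ?thesis
        by (intro exI[of _ "?L @ [0]"])
           (simp add: eq fg len orbit_form_0 s_elt_def mult.assoc del: map_map)
    qed
  qed
qed


section \<open>Signs of the coefficients\<close>

text \<open>Associating \<open>(1 + q) e n e n\<close> in two ways gives \<open>q e e n n + n e e n = q e e n n + e n n e\<close>.\<close>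

lemma s_t_commute: "t_elt * s_elt = s_elt * t_elt"
proof -
  have "q *\<^sub>P (gen_e * gen_e * gen_n * gen_n) + t_elt * s_elt
      = (1 + q) *\<^sub>P (gen_e * gen_n * gen_e) * gen_n"
    unfolding relation_ene by (simp add: distrib_right scale_mult_left s_elt_def t_elt_def mult.assoc)
  also have "\<dots> = gen_e * ((1 + q) *\<^sub>P (gen_n * gen_e * gen_n))"
    by (simp add: scale_mult_left scale_mult_right mult.assoc)
  also have "\<dots> = q *\<^sub>P (gen_e * gen_e * gen_n * gen_n) + s_elt * t_elt"
    unfolding relation_nen by (simp add: distrib_left scale_mult_right s_elt_def t_elt_def mult.assoc)
  finally show ?thesis
    by simp
qed

lemma t_s_power_commute: "t_elt * s_elt ^ r = s_elt ^ r * t_elt"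
  using power_commuting_commutes[OF s_t_commute[symmetric], of r] by simp

text \<open>For k at least 1 both q-integers involved are nonnegative; for k at most 0
  \<open>qnum_minus\<close> gives both a minus sign, which becomes the common sign.\<close>

lemma orbit_form_signs:
  obtains \<epsilon> \<alpha> \<beta> where "\<epsilon> \<in> {1, -1}" "\<alpha> \<in> nonneg_laurent" "\<beta> \<in> nonneg_laurent"
    "orbit_form k = \<epsilon> *\<^sub>P (\<beta> *\<^sub>P t_elt - \<alpha> *\<^sub>P s_elt)"
proof (cases "k \<ge> 1")
  case True
  then obtain j where k: "k = 1 + int j"
    by (auto simp: zle_iff_zadd)
  have "qnum k \<in> nonneg_laurent"
    using qnum_nonneg[of "Suc j"] by (simp add: k)
  moreover have "q * qnum (k - 1) \<in> nonneg_laurent"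
    by (simp add: k nonneg_laurent_mult qnum_nonneg)
  ultimately show thesis
    by (intro that[of 1 "q * qnum (k - 1)" "qnum k"]) (simp_all add: orbit_form_def)
next
  case False
  then have "k \<le> 0"
    by simp
  then obtain j where j: "0 = k + int j"
    by (auto simp only: zle_iff_zadd)
  then have k: "k = - int j"
    by simp
  \<comment> \<open>In the first, \<open>qnum_minus\<close> at 1 - k yields the power k - 1 of q,
    and the outer factor q raises it to k.\<close>
  let ?\<alpha> = "q powi k * qnum (int (Suc j))" and ?\<beta> = "q powi k * qnum (int j)"
  have "q * qnum (k - 1) = - ?\<alpha>"
    using qnum_minus[of "1 - k"] by (simp add: power_int_diff) (simp add: k)
  moreover have "qnum k = - ?\<beta>"
    using qnum_minus[of "int j"] by (simp add: k)
  ultimately have "orbit_form k = (-1) *\<^sub>P (?\<beta> *\<^sub>P t_elt - ?\<alpha> *\<^sub>P s_elt)"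
    by (simp add: orbit_form_def)
  moreover have "?\<alpha> \<in> nonneg_laurent" "?\<beta> \<in> nonneg_laurent"
    by (intro nonneg_laurent_mult nonneg_laurent_powi qnum_nonneg)+
  ultimately show thesis
    by (intro that[of "-1" ?\<alpha> ?\<beta>]) simp_all
qed

text \<open>Up to a global sign every factor is a nonnegative multiple of t minus one of s. The sign
  of a term therefore depends only on its exponent of s, and like terms add without
  cancellation.\<close>

lemma prod_orbit_form_signs:
  "\<exists>\<epsilon>\<in>{1, -1}. \<exists>a. (\<forall>r. a r \<in> nonneg_laurent) \<and> prod_list (map orbit_form L)
    = \<epsilon> *\<^sub>P (\<Sum>r\<le>length L. ((-1) ^ r * a r) *\<^sub>P (s_elt ^ r * t_elt ^ (length L - r)))"
proof (induction L)
  case Nil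
  show ?case
    by (intro bexI[of _ 1] exI[of _ "\<lambda>_. 1"]) auto
next
  case (Cons k L)
  define n where "n = length L"
  obtain \<epsilon> a where \<epsilon>: "\<epsilon> \<in> {1, -1}" and a: "\<And>r. a r \<in> nonneg_laurent"
    and L: "prod_list (map orbit_form L)
      = \<epsilon> *\<^sub>P (\<Sum>r\<le>n. ((-1) ^ r * a r) *\<^sub>P (s_elt ^ r * t_elt ^ (n - r)))"
    using Cons.IH unfolding n_def by blast
  obtain \<delta> \<alpha> \<beta> where \<delta>: "\<delta> \<in> {1, -1}" and \<alpha>: "\<alpha> \<in> nonneg_laurent" and \<beta>: "\<beta> \<in> nonneg_laurent"
    and k: "orbit_form k = \<delta> *\<^sub>P (\<beta> *\<^sub>P t_elt - \<alpha> *\<^sub>P s_elt)"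
    by (rule orbit_form_signs)
  \<comment> \<open>A monomial arises by a further s or a further t. Both guards matter:
    \<open>r - 1\<close> truncates at 0, and \<open>a r\<close> is arbitrary in
    \<open>nonneg_laurent\<close> beyond n.\<close>
  define b where "b r = (if r = 0 then 0 else \<alpha> * a (r - 1)) + (if r \<le> n then \<beta> * a r else 0)" for r
  let ?m = "\<lambda>r. s_elt ^ r * t_elt ^ (Suc n - r)"
  have "t_elt * (s_elt ^ r * t_elt ^ (n - r)) = ?m r" if "r \<le> n" for r
    using that by (simp add: Suc_diff_le t_s_power_commute power_commutes flip: mult.assoc power_Suc)
                  (simp add: mult.assoc)
  then have t: "\<beta> *\<^sub>P t_elt * (\<Sum>r\<le>n. ((-1) ^ r * a r) *\<^sub>P (s_elt ^ r * t_elt ^ (n - r)))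
      = (\<Sum>r\<le>Suc n. ((-1) ^ r * (if r \<le> n then \<beta> * a r else 0)) *\<^sub>P ?m r)"
    by (auto simp: scale_mult_left scale_mult_right sum_distrib_left palg.scale_sum_right mult_ac
             intro!: sum.cong)
  have "s_elt * (s_elt ^ r * t_elt ^ (n - r)) = ?m (Suc r)" for r
    by (simp add: mult.assoc)
  \<comment> \<open>Raising r by one flips (-1)^r; the resulting minus cancels the one in front of
    the s term of the factor.\<close>
  then have s: "\<alpha> *\<^sub>P s_elt * (\<Sum>r\<le>n. ((-1) ^ r * a r) *\<^sub>P (s_elt ^ r * t_elt ^ (n - r)))
      = - (\<Sum>r\<le>Suc n. ((-1) ^ r * (if r = 0 then 0 else \<alpha> * a (r - 1))) *\<^sub>P ?m r)"
    unfolding sum.atMost_Suc_shift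
    by (auto simp: scale_mult_left scale_mult_right sum_distrib_left palg.scale_sum_right mult_ac sum_negf
             intro!: sum.cong)
  let ?S = "\<Sum>r\<le>n. ((-1) ^ r * a r) *\<^sub>P (s_elt ^ r * t_elt ^ (n - r))"
  have "prod_list (map orbit_form (k # L))
      = (\<delta> * \<epsilon>) *\<^sub>P (\<beta> *\<^sub>P t_elt * ?S - \<alpha> *\<^sub>P s_elt * ?S)"
    by (simp only: list.map prod_list.Cons k L scale_mult_left scale_mult_right left_diff_distrib
                   palg.scale_scale mult.commute)
  also have "\<beta> *\<^sub>P t_elt * ?S - \<alpha> *\<^sub>P s_elt * ?S = (\<Sum>r\<le>Suc n. ((-1) ^ r * b r) *\<^sub>P ?m r)"
    unfolding s t diff_minus_eq_add sum.distrib[symmetric]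
    by (simp only: b_def distrib_left palg.scale_left_distrib add.commute)
  finally have "prod_list (map orbit_form (k # L))
      = (\<delta> * \<epsilon>) *\<^sub>P (\<Sum>r\<le>Suc n. ((-1) ^ r * b r) *\<^sub>P ?m r)" .
  moreover have "\<delta> * \<epsilon> \<in> {1, -1}"
    using \<delta> \<epsilon> by auto
  moreover have "\<forall>r. b r \<in> nonneg_laurent"
    by (simp add: b_def \<alpha> \<beta> a nonneg_laurent_add nonneg_laurent_mult)
  ultimately show ?case
    unfolding n_def by auto
qed


section \<open>Weight modules and uniqueness\<close>

text \<open>
  These weights are normalised by \<open>weight b 0 = 1\<close>; they solve
  \<open>(1 + q) \<lambda>\<^sub>k = q \<lambda>\<^sub>k\<^sub>+\<^sub>1 + \<lambda>\<^sub>k\<^sub>-\<^sub>1\<close>, which is what both defining relations amount to.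
\<close>

definition weight :: "ratfun \<Rightarrow> int \<Rightarrow> ratfun"
  where "weight b k = 1 + b * (1 - q powi (- k))"

lemma weight_rec: "(1 + q) * weight b k = q * weight b (k + 1) + weight b (k - 1)"
  by (simp add: weight_def power_int_add power_int_diff power_int_minus divide_simps)
     (simp add: algebra_simps)

text \<open>The letters shift in opposite directions, so s and t act as multiplication by
  \<open>weight b (k + 1)\<close> and \<open>weight b k\<close>. Functions of arbitrary support are
  allowed, so the constant 1 can serve as test vector.\<close>

fun letter_act :: "ratfun \<Rightarrow> letter \<Rightarrow> (int \<Rightarrow> ratfun) \<Rightarrow> int \<Rightarrow> ratfun"
  where
    "letter_act b letter_n f k = f (k - 1)"
  | "letter_act b letter_e f k = weight b (k + 1) * f (k + 1)"

definition word_act :: "ratfun \<Rightarrow> free_word \<Rightarrow> (int \<Rightarrow> ratfun) \<Rightarrow> int \<Rightarrow> ratfun"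
  where "word_act b u = foldr (letter_act b) (letters u)"

lemma word_act_plus: "word_act b (u + v) f = word_act b u (word_act b v f)"
  by (simp add: word_act_def plus_free_word_def)

lemma letter_act_add: "letter_act b x (\<lambda>k. f k + g k) k = letter_act b x f k + letter_act b x g k"
  by (cases x) (simp_all add: distrib_left)

lemma letter_act_scale: "letter_act b x (\<lambda>k. c * f k) k = c * letter_act b x f k"
  by (cases x) simp_all

lemma word_act_add: "word_act b u (\<lambda>k. f k + g k) k = word_act b u f k + word_act b u g k"
proof -
  have "foldr (letter_act b) xs (\<lambda>k. f k + g k)
      = (\<lambda>k. foldr (letter_act b) xs f k + foldr (letter_act b) xs g k)" for xs
    by (induction xs) (simp_all add: letter_act_add)
  then show ?thesis
    by (simp add: word_act_def)
qed

lemma word_act_scale: "word_act b u (\<lambda>k. c * f k) k = c * word_act b u f k"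
proof -
  have "foldr (letter_act b) xs (\<lambda>k. c * f k) = (\<lambda>k. c * foldr (letter_act b) xs f k)" for xs
    by (induction xs) (simp_all add: letter_act_scale)
  then show ?thesis
    by (simp add: word_act_def)
qed

lemma word_act_0 [simp]: "word_act b u (\<lambda>k. 0) = (\<lambda>k. 0)"
  using word_act_scale[of b u 0 "\<lambda>k. 0"] by auto

section \<open>Extension of the action to the free algebra\<close>

definition free_act :: "ratfun \<Rightarrow> free_algebra \<Rightarrow> (int \<Rightarrow> ratfun) \<Rightarrow> int \<Rightarrow> ratfun"
  where "free_act b x f k = (\<Sum>u\<in>Poly_Mapping.keys x. Poly_Mapping.lookup x u * word_act b u f k)"

lemma free_act_superset:
  assumes "finite A" "Poly_Mapping.keys x \<subseteq> A"
  shows "free_act b x f k = (\<Sum>u\<in>A. Poly_Mapping.lookup x u * word_act b u f k)"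
  unfolding free_act_def using assms
  by (intro sum.mono_neutral_left) (auto simp: in_keys_iff)

lemma free_act_add: "free_act b (x + y) f k = free_act b x f k + free_act b y f k"
proof -
  let ?A = "Poly_Mapping.keys x \<union> Poly_Mapping.keys y"
  have "Poly_Mapping.keys (x + y) \<subseteq> ?A"
    by (rule Poly_Mapping.keys_add)
  then show ?thesis
    by (simp add: free_act_superset[of ?A] lookup_add distrib_right sum.distrib)
qed

lemma free_act_single [simp]: "free_act b (Poly_Mapping.single u c) f k = c * word_act b u f k"
  by (simp add: free_act_superset[of "{u}"])

lemma free_act_zero [simp]: "free_act b 0 f k = 0"
  by (simp add: free_act_def)

lemma free_act_diff: "free_act b (x - y) f k = free_act b x f k - free_act b y f k"
  using free_act_add[of b "x - y" y f k] by simp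

lemma free_act_0 [simp]: "free_act b x (\<lambda>k. 0) k = 0"
  by (simp add: free_act_def)

lemma word_act_free_act:
  "word_act b u (free_act b y f) k = free_act b (Poly_Mapping.single u 1 * y) f k"
proof (induction y arbitrary: k rule: free_algebra_induct)
  case zero
  have "free_act b 0 f = (\<lambda>k. 0)"
    by auto
  then show ?case
    by simp
next
  case (add y v c)
  have "free_act b (y + Poly_Mapping.single v c) f
      = (\<lambda>k. free_act b y f k + c * word_act b v f k)"
    by (auto simp: free_act_add)
  then show ?case
    by (simp add: word_act_add word_act_scale add.IH distrib_left mult_single free_act_add
                  word_act_plus)
qed

lemma free_act_mult: "free_act b (x * y) f k = free_act b x (free_act b y f) k"
proof (induction x arbitrary: k rule: free_algebra_induct)
  case zero
  show ?case by simp
next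
  case (add x u c)
  have "Poly_Mapping.single u c * y = free_const c * (Poly_Mapping.single u 1 * y)"
    by (simp add: free_const_def mult_single flip: mult.assoc)
  moreover have "free_act b (free_const c * z) f k = c * free_act b z f k" for z
    by (induction z rule: free_algebra_induct)
       (simp_all add: free_const_def distrib_left mult_single free_act_add word_act_plus)
  ultimately show ?case
    by (simp add: free_act_add add.IH distrib_right word_act_free_act)
qed

lemma free_act_const: "free_act b (free_const c) f k = c * f k"
  by (simp add: free_const_def word_act_def zero_free_word_def)

lemma free_act_gen: "free_act b (free_gen x) f k = letter_act b x f k"
  by (simp add: free_gen_def word_act_def)

text \<open>At k, the relation for ene is \<open>weight_rec\<close> at k + 1 times a common factor,
  and that for nen is \<open>weight_rec\<close> at k. Right multiplication by u replaces f by its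
  image under u, hence the induction over arbitrary f.\<close>

lemma free_act_rel_ideal: "x \<in> rel_ideal \<Longrightarrow> free_act b x f k = 0"
proof (induction x arbitrary: f k rule: rel_ideal.induct)
  case rel_ene
  show ?case
    using arg_cong[OF weight_rec[of b "k + 1"], of "\<lambda>x. x * (weight b (k + 1) * f (k + 1))"]
    by (simp add: free_act_diff free_act_add free_act_mult free_act_const free_act_gen algebra_simps)
next
  case rel_nen
  show ?case
    using arg_cong[OF weight_rec[of b k], of "\<lambda>x. x * f (k - 1)"]
    by (simp add: free_act_diff free_act_add free_act_mult free_act_const free_act_gen algebra_simps)
next
  case zero
  show ?case by simp
next
  case (add x y)
  then show ?case by (simp add: free_act_add)
next
  case (mult_left x u)
  then have "free_act b x f = (\<lambda>k. 0)" by auto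
  then show ?case by (simp add: free_act_mult)
next
  case (mult_right x u)
  then show ?case by (simp add: free_act_mult)
qed

section \<open>Descent to the presented algebra and values on zigzag monomials\<close>

lift_definition palg_act :: "ratfun \<Rightarrow> palg \<Rightarrow> (int \<Rightarrow> ratfun) \<Rightarrow> int \<Rightarrow> ratfun"
  is free_act
proof (intro ext)
  fix b x y f k
  assume "pcong x y"
  then show "free_act b x f k = free_act b y f k"
    using free_act_rel_ideal[of "x - y" b f k] by (simp add: pcong_def free_act_diff)
qed

lemma palg_act_add: "palg_act b (x + y) f k = palg_act b x f k + palg_act b y f k"
  by transfer (rule free_act_add)

lemma palg_act_0: "palg_act b 0 f k = 0"
  by transfer simp

lemma palg_act_1: "palg_act b 1 f k = f k"
  by transfer (metis free_act_const free_const_1 mult_1)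

lemma palg_act_mult: "palg_act b (x * y) f k = palg_act b x (palg_act b y f) k"
  by transfer (rule free_act_mult)

lemma palg_act_scale: "palg_act b (c *\<^sub>P x) f k = c * palg_act b x f k"
  by transfer (simp add: free_act_mult free_act_const)

lemma palg_act_gen: "palg_act b (gen x) f k = letter_act b x f k"
  by transfer (rule free_act_gen)

lemma palg_act_sum: "palg_act b (\<Sum>i\<in>A. g i) f k = (\<Sum>i\<in>A. palg_act b (g i) f k)"
  by (induction A rule: infinite_finite_induct) (simp_all add: palg_act_0 palg_act_add)

lemma palg_act_s_power: "palg_act b (s_elt ^ r) f k = weight b (k + 1) ^ r * f k"
  by (induction r arbitrary: k)
     (simp_all add: palg_act_1 palg_act_mult s_elt_def palg_act_gen)

lemma palg_act_t_power: "palg_act b (t_elt ^ r) f k = weight b k ^ r * f k"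
  by (induction r arbitrary: k)
     (simp_all add: palg_act_1 palg_act_mult t_elt_def palg_act_gen)

lemma palg_act_n_power: "palg_act b (gen_n ^ r) f k = f (k - int r)"
  by (induction r arbitrary: k)
     (simp_all add: palg_act_1 palg_act_mult palg_act_gen algebra_simps)

text \<open>Powers of n fix the constant function, and powers of t act as 1 at position 0 because
  \<open>weight b 0\<close> is 1; only the power of s is seen.\<close>

lemma palg_act_zigzag: "palg_act b (zigzag m n r) (\<lambda>_. 1) 0 = weight b 1 ^ r"
  by (simp add: zigzag_def palg_act_mult palg_act_s_power palg_act_t_power palg_act_n_power weight_def)

lemma zigzag_independent:
  assumes "(\<Sum>r\<le>n. c r *\<^sub>P zigzag m n r) = (\<Sum>r\<le>n. d r *\<^sub>P zigzag m n r)" and "r \<le> n"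
  shows "c r = d r"
proof -
  have *: "(\<Sum>r\<le>n. c r * x ^ r) = (\<Sum>r\<le>n. d r * x ^ r)" for x
  proof -
    \<comment> \<open>Solves \<open>weight b 1 = x\<close>, which is affine in b with slope 1 - 1/q;
      thus every x is attained.\<close>
    define b where "b = (x - 1) / (1 - inverse q)"
    have "1 - inverse q \<noteq> 0"
      by simp
    then have "weight b 1 = x"
      by (simp add: weight_def b_def)
    then show ?thesis
      using arg_cong[OF assms(1), of "\<lambda>z. palg_act b z (\<lambda>_. 1) 0"]
      by (simp add: palg_act_sum palg_act_scale palg_act_zigzag)
  qed
  have "(\<Sum>r\<le>n. monom (c r) r) = (\<Sum>r\<le>n. monom (d r) r)" (is "?p = ?q")
  proof (rule ccontr)
    assume "?p \<noteq> ?q"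
    then have "finite {x. poly (?p - ?q) x = 0}"
      by (intro poly_roots_finite) simp
    moreover have "{x. poly (?p - ?q) x = 0} = UNIV"
      using * by (simp add: poly_sum poly_monom)
    ultimately show False
      using infinite_ratfun by simp
  qed
  then have "coeff ?p r = coeff ?q r"
    by simp
  then show ?thesis
    using \<open>r \<le> n\<close> by (simp add: coeff_sum)
qed

theorem theorem3p14:
  fixes m n :: nat and w :: "letter list"
  assumes "n \<le> m"
    and "count_list w letter_n = m"
    and "count_list w letter_e = n"
  shows "\<exists>c :: nat \<Rightarrow> ratfun.
      word w = (\<Sum>r\<le>n. c r *\<^sub>P zigzag m n r) \<and>
      (\<forall>c'. word w = (\<Sum>r\<le>n. c' r *\<^sub>P zigzag m n r) \<longrightarrow> (\<forall>r\<le>n. c' r = c r)) \<and>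
      (\<forall>r\<le>n. globally_signed (c r))"
proof -
  \<comment> \<open>As n is at most m, the truncated exponent of \<open>gen_e\<close> is
    zero.\<close>
  obtain L where L: "length L = n" and w: "word w = prod_list (map orbit_form L) * gen_n ^ (m - n)"
    using word_factorisation[of w] assms by auto
  obtain \<epsilon> a where \<epsilon>: "\<epsilon> \<in> {1, -1}" and a: "\<And>r. a r \<in> nonneg_laurent"
    and prod: "prod_list (map orbit_form L)
      = \<epsilon> *\<^sub>P (\<Sum>r\<le>n. ((-1) ^ r * a r) *\<^sub>P (s_elt ^ r * t_elt ^ (n - r)))"
    using prod_orbit_form_signs[of L] unfolding L by blast
  \<comment> \<open>The alternating sign joins the global one: the sign of a coefficient may depend
    on r.\<close>
  define c where "c r = \<epsilon> * (-1) ^ r * a r" for r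
  have word: "word w = (\<Sum>r\<le>n. c r *\<^sub>P zigzag m n r)"
    unfolding w prod
    by (simp add: c_def zigzag_def scale_mult_left sum_distrib_right palg.scale_sum_right mult.assoc)
  have "\<epsilon> * (-1) ^ r \<in> {1, -1}" for r
    using \<epsilon> by (cases "even r") auto
  then have "globally_signed (c r)" for r
    unfolding globally_signed_def c_def using a by blast
  moreover have "c' r = c r" if "word w = (\<Sum>r\<le>n. c' r *\<^sub>P zigzag m n r)" "r \<le> n" for c' r
    by (rule zigzag_independent[where m = m, OF _ \<open>r \<le> n\<close>]) (simp flip: word that(1))
  ultimately show ?thesis
    using word by blast
qed

end
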